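(* Fix real numbers $c<d$. Among the inclusion maps $\mathrm{(ffid^{[c,d]})}\hookrightarrow\mathrm{(ffid)}$, $\mathrm{(ffid)}\hookrightarrow\mathrm{(fid)}$, $\mathrm{(ffid)}\hookrightarrow\mathrm{(cfid)}$, $\mathrm{(cfid)}\hookrightarrow\mathrm{(cid)}$, $\mathrm{(fid)}\hookrightarrow\mathrm{(cid)}$, $\mathrm{(fid)}\hookrightarrow\mathrm{(pfd)}$, $\mathrm{(cid)}\hookrightarrow\mathrm{(rid)}$, $\mathrm{(pfd)}\hookrightarrow\mathrm{(rid)}$, only $\mathrm{(ffid)}\hookrightarrow\mathrm{(fid)}$ and $\mathrm{(cfid)}\hookrightarrow\mathrm{(cid)}$ are inclusions of open subsets (that is, these two are inclusions of open subsets and the other six are not), where each space carries the topology induced by the interleaving distance.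
   Context: Fix a field $\mathbf{k}$. A persistence module is a functor $M:(\mathbb{R},\le)\to \mathrm{Vect}_{\mathbf{k}}$; "persistence module" means isomorphism class. For an interval $J\subset\mathbb{R}$, the interval module $J$ is $\mathbf{k}$ at points of $J$ and $0$ elsewhere, with identity maps between points of $J$ and zero maps otherwise. For $\varepsilon\ge 0$, $M,N$ are $\varepsilon$-interleaved if there are families of linear maps $\varphi_a:M(a)\to N(a+\varepsilon)$ and $\psi_a:N(a)\to M(a+\varepsilon)$, natural in $a\in\mathbb{R}$, with $\psi_{a+\varepsilon}\varphi_a=M(a\le a+2\varepsilon)$ and $\varphi_{a+\varepsilon}\psi_a=N(a\le a+2\varepsilon)$ for all $a$. The interleaving distance is $d_I(M,N)=\inf\{\varepsilon\ge0 : M,N \text{ are } \varepsilon\text{-interleaved}\}$ ($\infty$ if there is none). It is an extended pseudometric; the induced topology has the open balls $B_r(M)=\{N: d_I(M,N)<r\}$, $r>0$, as a base. Sets of persistence modules: $\mathrm{(fid)}$: finite direct sums of interval modules (including the zero module); $\mathrm{(ffid)}$: those in $\mathrm{(fid)}$ with all intervals finite (bounded); $\mathrm{(ffid^{[c,d]})}$: those in $\mathrm{(ffid)}$ with all intervals contained in $[c,d]$; $\mathrm{(cid)}$: direct sums of countably many interval modules; $\mathrm{(cfid)}$: those in $\mathrm{(cid)}$ with all intervals finite (bounded); $\mathrm{(pfd)}$: persistence modules $M$ with every $M(a)$ finite dimensional; $\mathrm{(rid)}$: direct sums $\bigoplus_{\alpha\in A}I_\alpha$ of interval modules with $|A|\le|\mathbb{R}|$.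 *)

theory Defs
  imports "HOL-Analysis.Analysis" "HOL-Library.Function_Algebras"
begin

section \<open>Persistence modules\<close>

text \<open>
  Vector spaces over the field \<open>'k\<close> are taken to be linear subspaces of the space of all
  functions \<open>real \<Rightarrow> 'k\<close>. Every vector space of dimension at most the cardinality of the reals
  is isomorphic to such a subspace, so every pointwise finite-dimensional module and every direct
  sum of at most continuum many interval modules occurs here up to isomorphism.
\<close>

definition fscale :: "'k::field \<Rightarrow> (real \<Rightarrow> 'k) \<Rightarrow> (real \<Rightarrow> 'k)" where
  "fscale r f = (\<lambda>t. r * f t)"

interpretation fv: vector_space fscale
  by unfold_locales (auto simp: fscale_def fun_eq_iff algebra_simps)

definition linear_on ::
  "(real \<Rightarrow> 'k::field) set \<Rightarrow> (real \<Rightarrow> 'k) set \<Rightarrow> ((real \<Rightarrow> 'k) \<Rightarrow> (real \<Rightarrow> 'k)) \<Rightarrow> bool" where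
  "linear_on S T f \<longleftrightarrow> f ` S \<subseteq> T
     \<and> (\<forall>x\<in>S. \<forall>y\<in>S. f (x + y) = f x + f y)
     \<and> (\<forall>r. \<forall>x\<in>S. f (fscale r x) = fscale r (f x))"

text \<open>
  Only the values of \<open>pmap M a b\<close> with \<open>a \<le> b\<close> on \<open>pspace M a\<close> are meaningful.
\<close>

record 'v pers =
  pspace :: "real \<Rightarrow> 'v set"
  pmap :: "real \<Rightarrow> real \<Rightarrow> 'v \<Rightarrow> 'v"

type_synonym 'k pmodule = "(real \<Rightarrow> 'k) pers"

definition persistence_module :: "'k::field pmodule \<Rightarrow> bool" where
  "persistence_module M \<longleftrightarrow>
     (\<forall>a. fv.subspace (pspace M a))
     \<and> (\<forall>a b. a \<le> b \<longrightarrow> linear_on (pspace M a) (pspace M b) (pmap M a b))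
     \<and> (\<forall>a. \<forall>x\<in>pspace M a. pmap M a a x = x)
     \<and> (\<forall>a b c. a \<le> b \<longrightarrow> b \<le> c \<longrightarrow>
          (\<forall>x\<in>pspace M a. pmap M b c (pmap M a b x) = pmap M a c x))"

definition pers_morphism ::
  "'k::field pmodule \<Rightarrow> 'k pmodule \<Rightarrow> (real \<Rightarrow> (real \<Rightarrow> 'k) \<Rightarrow> (real \<Rightarrow> 'k)) \<Rightarrow> bool" where
  "pers_morphism M N \<phi> \<longleftrightarrow>
     (\<forall>a. linear_on (pspace M a) (pspace N a) (\<phi> a))
     \<and> (\<forall>a b. a \<le> b \<longrightarrow> (\<forall>x\<in>pspace M a. \<phi> b (pmap M a b x) = pmap N a b (\<phi> a x)))"

definition pers_iso :: "'k::field pmodule \<Rightarrow> 'k pmodule \<Rightarrow> bool" where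
  "pers_iso M N \<longleftrightarrow>
     (\<exists>\<phi>. pers_morphism M N \<phi> \<and> (\<forall>a. bij_betw (\<phi> a) (pspace M a) (pspace N a)))"

definition iso_rel :: "('k::field pmodule \<times> 'k pmodule) set" where
  "iso_rel = {(M, N). persistence_module M \<and> persistence_module N \<and> pers_iso M N}"

definition iso_class :: "'k::field pmodule \<Rightarrow> 'k pmodule set" where
  "iso_class M = iso_rel `` {M}"

type_synonym 'k pclass = "'k pmodule set"


section \<open>Interleaving distance\<close>

definition shift :: "real \<Rightarrow> 'v pers \<Rightarrow> 'v pers" where
  "shift \<epsilon> M = \<lparr>pspace = (\<lambda>a. pspace M (a + \<epsilon>)), pmap = (\<lambda>a b. pmap M (a + \<epsilon>) (b + \<epsilon>))\<rparr>"

definition interleaved :: "real \<Rightarrow> 'k::field pmodule \<Rightarrow> 'k pmodule \<Rightarrow> bool" where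
  "interleaved \<epsilon> M N \<longleftrightarrow>
     (\<exists>\<phi> \<psi>. pers_morphism M (shift \<epsilon> N) \<phi> \<and> pers_morphism N (shift \<epsilon> M) \<psi>
       \<and> (\<forall>a. \<forall>x\<in>pspace M a. \<psi> (a + \<epsilon>) (\<phi> a x) = pmap M a (a + 2 * \<epsilon>) x)
       \<and> (\<forall>a. \<forall>y\<in>pspace N a. \<phi> (a + \<epsilon>) (\<psi> a y) = pmap N a (a + 2 * \<epsilon>) y))"

definition interleaving_dist :: "'k::field pmodule \<Rightarrow> 'k pmodule \<Rightarrow> ereal" where
  "interleaving_dist M N = Inf {ereal \<epsilon> | \<epsilon>. 0 \<le> \<epsilon> \<and> interleaved \<epsilon> M N}"

text \<open>
  The infima over representatives only serve to avoid choosing them; see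
  \<open>class_dist_iso_class\<close> below.
\<close>

definition class_dist :: "'k::field pclass \<Rightarrow> 'k pclass \<Rightarrow> ereal" where
  "class_dist P Q = (INF M\<in>P. INF N\<in>Q. interleaving_dist M N)"

definition dI_ball :: "'k::field pclass set \<Rightarrow> 'k pclass \<Rightarrow> real \<Rightarrow> 'k pclass set" where
  "dI_ball Y P r = {Q \<in> Y. class_dist P Q < ereal r}"

text \<open>
  By the triangle inequality the balls generating this topology form a base of it.
\<close>

definition dI_topology :: "'k::field pclass set \<Rightarrow> 'k pclass topology" where
  "dI_topology Y = topology_generated_by {dI_ball Y P r | P r. P \<in> Y \<and> 0 < r}"


section \<open>Interval modules and direct sums\<close>

definition interval_module :: "real set \<Rightarrow> 'k::field pers" where
  "interval_module J = \<lparr>pspace = (\<lambda>a. if a \<in> J then UNIV else {0}),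
     pmap = (\<lambda>a b x. if a \<in> J \<and> b \<in> J then x else 0)\<rparr>"

definition direct_sum :: "'i set \<Rightarrow> ('i \<Rightarrow> 'v::zero pers) \<Rightarrow> ('i \<Rightarrow> 'v) pers" where
  "direct_sum A M =
     \<lparr>pspace = (\<lambda>a. {f. finite {i. f i \<noteq> 0} \<and> (\<forall>i\<in>A. f i \<in> pspace (M i) a)
                       \<and> (\<forall>i. i \<notin> A \<longrightarrow> f i = 0)}),
      pmap = (\<lambda>a b f i. if i \<in> A then pmap (M i) a b (f i) else 0)\<rparr>"

text \<open>
  The direct sum of the interval modules \<open>J i\<close>, \<open>i \<in> A\<close>. Index sets are sets of reals: any index set
  of cardinality at most that of the reals is in bijection with one of these.
\<close>

definition interval_sum :: "real set \<Rightarrow> (real \<Rightarrow> real set) \<Rightarrow> 'k::field pmodule" where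
  "interval_sum A J = direct_sum A (\<lambda>i. interval_module (J i))"

definition real_interval :: "real set \<Rightarrow> bool" where
  "real_interval J \<longleftrightarrow> is_interval J \<and> J \<noteq> {}"


section \<open>The spaces of persistence modules\<close>

definition fid :: "'k::field pclass set" where
  "fid = {iso_class (interval_sum A J) | A J. finite A \<and> (\<forall>i\<in>A. real_interval (J i))}"

definition ffid :: "'k::field pclass set" where
  "ffid = {iso_class (interval_sum A J) | A J.
             finite A \<and> (\<forall>i\<in>A. real_interval (J i) \<and> bounded (J i))}"

definition ffid_within :: "real \<Rightarrow> real \<Rightarrow> 'k::field pclass set" where
  "ffid_within c d = {iso_class (interval_sum A J) | A J.
             finite A \<and> (\<forall>i\<in>A. real_interval (J i) \<and> bounded (J i) \<and> J i \<subseteq> {c..d})}"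

definition cid :: "'k::field pclass set" where
  "cid = {iso_class (interval_sum A J) | A J. countable A \<and> (\<forall>i\<in>A. real_interval (J i))}"

definition cfid :: "'k::field pclass set" where
  "cfid = {iso_class (interval_sum A J) | A J.
             countable A \<and> (\<forall>i\<in>A. real_interval (J i) \<and> bounded (J i))}"

definition rid :: "'k::field pclass set" where
  "rid = {iso_class (interval_sum A J) | A J. \<forall>i\<in>A. real_interval (J i)}"

definition pfd :: "'k::field pclass set" where
  "pfd = {iso_class M | M. persistence_module M
             \<and> (\<forall>a. \<exists>B. finite B \<and> fv.span B = pspace M a)}"


section \<open>Well-definedness\<close>

lemma persistence_module_interval_sum:
  assumes "\<forall>i\<in>A. real_interval (J i)"
  shows "persistence_module (interval_sum A J :: 'k::field pmodule)"
proof -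
  have mem: "f \<in> pspace (interval_sum A J :: 'k pmodule) a \<longleftrightarrow>
      finite {i. f i \<noteq> 0} \<and> (\<forall>i. f i \<noteq> 0 \<longrightarrow> i \<in> A \<and> a \<in> J i)" for f a
    by (auto simp: interval_sum_def direct_sum_def interval_module_def split: if_splits)
  have app: "pmap (interval_sum A J :: 'k pmodule) a b f =
      (\<lambda>i. if i \<in> A \<and> a \<in> J i \<and> b \<in> J i then f i else 0)" for f a b
    by (auto simp: interval_sum_def direct_sum_def interval_module_def)
  have fin2: "finite {i. f i + g i \<noteq> 0}" if "finite {i. f i \<noteq> 0}" "finite {i. g i \<noteq> 0}"
    for f g :: "real \<Rightarrow> 'k"
    by (rule finite_subset[OF _ finite_UnI[OF that]]) auto
  have fin1: "finite {i. (if P i then f i else 0) \<noteq> 0}" if "finite {i. f i \<noteq> 0}"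
    for f :: "real \<Rightarrow> 'k" and P
    by (rule finite_subset[OF _ that]) auto
  have fin3: "finite {i. r * f i \<noteq> 0}" if "finite {i. f i \<noteq> 0}" for f :: "real \<Rightarrow> 'k" and r
    by (rule finite_subset[OF _ that]) auto
  have sub: "fv.subspace (pspace (interval_sum A J :: 'k pmodule) a)" for a
    unfolding fv.subspace_def mem fscale_def plus_fun_apply zero_fun_apply
  proof (intro conjI ballI allI)
    fix f g :: "real \<Rightarrow> 'k"
    assume "f \<in> pspace (interval_sum A J) a" "g \<in> pspace (interval_sum A J) a"
    then have fg: "finite {i. f i \<noteq> 0} \<and> (\<forall>i. f i \<noteq> 0 \<longrightarrow> i \<in> A \<and> a \<in> J i)"
        "finite {i. g i \<noteq> 0} \<and> (\<forall>i. g i \<noteq> 0 \<longrightarrow> i \<in> A \<and> a \<in> J i)"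
      by (simp_all add: mem)
    show "finite {i. f i + g i \<noteq> 0}"
      using fg fin2 by blast
    show "f i + g i \<noteq> 0 \<longrightarrow> i \<in> A \<and> a \<in> J i" for i
      using fg by (metis add_0)
  next
    fix r and f :: "real \<Rightarrow> 'k"
    assume "f \<in> pspace (interval_sum A J) a"
    then have f: "finite {i. f i \<noteq> 0} \<and> (\<forall>i. f i \<noteq> 0 \<longrightarrow> i \<in> A \<and> a \<in> J i)"
      by (simp add: mem)
    show "finite {i. r * f i \<noteq> 0}"
      using f fin3 by blast
    show "r * f i \<noteq> 0 \<longrightarrow> i \<in> A \<and> a \<in> J i" for i
      using f by simp
  qed auto
  have between: "b \<in> J i" if "i \<in> A" "a \<in> J i" "c \<in> J i" "a \<le> b" "b \<le> c" for i a b c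
    using assms that unfolding real_interval_def is_interval_1 by blast
  have lin: "linear_on (pspace (interval_sum A J :: 'k pmodule) a) (pspace (interval_sum A J) b)
      (pmap (interval_sum A J) a b)" for a b
    unfolding linear_on_def
  proof (intro conjI ballI allI)
    show "pmap (interval_sum A J) a b ` pspace (interval_sum A J :: 'k pmodule) a
        \<subseteq> pspace (interval_sum A J) b"
      using fin1 by (auto simp: image_subset_iff mem app)
  qed (simp_all add: app fscale_def fun_eq_iff)
  have comp: "pmap (interval_sum A J) b c (pmap (interval_sum A J) a b x) = pmap (interval_sum A J) a c x"
    if "a \<le> b" "b \<le> c" for a b c and x :: "real \<Rightarrow> 'k"
    unfolding app by (rule ext) (simp, metis between that)
  show ?thesis
    unfolding persistence_module_def
  proof (intro conjI allI impI ballI)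
    show "pmap (interval_sum A J) a a x = x" if "x \<in> pspace (interval_sum A J :: 'k pmodule) a" for a x
      using that unfolding mem app by (auto simp: fun_eq_iff)
  qed (rule sub lin comp; assumption?)+
qed

lemma linear_on_compose:
  "linear_on S T f \<Longrightarrow> linear_on T U g \<Longrightarrow> linear_on S U (\<lambda>x. g (f x))"
  unfolding linear_on_def by (simp add: image_subset_iff)

lemma pers_morphism_compose:
  "pers_morphism L M f \<Longrightarrow> pers_morphism M N g \<Longrightarrow> pers_morphism L N (\<lambda>a x. g a (f a x))"
  unfolding pers_morphism_def
  by (auto intro: linear_on_compose) (simp add: linear_on_def image_subset_iff)

lemma pers_morphism_shift:
  "pers_morphism M N f \<Longrightarrow> pers_morphism (shift \<epsilon> M) (shift \<epsilon> N) (\<lambda>a. f (a + \<epsilon>))"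
  unfolding pers_morphism_def shift_def by simp

lemma pers_iso_inverse:
  assumes "pers_morphism M N f" "\<forall>a. bij_betw (f a) (pspace M a) (pspace N a)"
    "persistence_module M"
  shows "pers_morphism N M (\<lambda>a. inv_into (pspace M a) (f a))"
proof -
  let ?g = "\<lambda>a. inv_into (pspace M a) (f a)"
  have gf: "?g a (f a x) = x" if "x \<in> pspace M a" for a x
    by (rule bij_betw_inv_into_left[OF assms(2)[rule_format] that])
  have surj: "\<exists>x\<in>pspace M a. y = f a x" if "y \<in> pspace N a" for a y
    using assms(2) that by (metis bij_betw_imp_surj_on imageE)
  have sub: "fv.subspace (pspace M a)" for a
    using assms(3) by (simp add: persistence_module_def)
  have lin: "linear_on (pspace M a) (pspace N a) (f a)" for a
    using assms(1) by (simp add: pers_morphism_def)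
  have map: "pmap M a b x \<in> pspace M b" if "a \<le> b" "x \<in> pspace M a" for a b x
    using assms(3) that unfolding persistence_module_def linear_on_def image_subset_iff by simp
  have "linear_on (pspace N a) (pspace M a) (?g a)" for a
    unfolding linear_on_def
  proof (intro conjI ballI allI)
    show "?g a ` pspace N a \<subseteq> pspace M a"
    proof
      fix x assume "x \<in> ?g a ` pspace N a"
      then obtain u where "u \<in> pspace M a" "x = ?g a (f a u)"
        using surj by blast
      then show "x \<in> pspace M a"
        using gf by metis
    qed
  next
    fix y z assume "y \<in> pspace N a" "z \<in> pspace N a"
    then obtain u v where "u \<in> pspace M a" "y = f a u" "v \<in> pspace M a" "z = f a v"
      using surj by blast
    moreover have "f a (u + v) = f a u + f a v"
      using lin calculation by (simp add: linear_on_def)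
    ultimately show "?g a (y + z) = ?g a y + ?g a z"
      using gf sub by (metis fv.subspace_add)
  next
    fix r y assume "y \<in> pspace N a"
    then obtain u where "u \<in> pspace M a" "y = f a u"
      using surj by blast
    moreover have "f a (fscale r u) = fscale r (f a u)"
      using lin calculation by (simp add: linear_on_def)
    ultimately show "?g a (fscale r y) = fscale r (?g a y)"
      using gf sub by (metis fv.subspace_scale)
  qed
  moreover have "?g b (pmap N a b y) = pmap M a b (?g a y)"
    if ab: "a \<le> b" and y: "y \<in> pspace N a" for a b y
  proof -
    obtain u where u: "u \<in> pspace M a" "y = f a u"
      using surj[OF y] by blast
    then have "pmap N a b y = f b (pmap M a b u)"
      using assms(1) ab by (simp add: pers_morphism_def)
    then show ?thesis
      using gf map u ab by simp
  qed
  ultimately show ?thesis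
    by (simp add: pers_morphism_def)
qed

lemma equiv_iso_rel: "equiv {M. persistence_module M} (iso_rel :: ('k::field pmodule \<times> _) set)"
proof (rule equivI)
  show "iso_rel \<subseteq> {M :: 'k pmodule. persistence_module M} \<times> {M. persistence_module M}"
    by (auto simp: iso_rel_def)
  have "pers_iso M M" for M :: "'k pmodule"
    unfolding pers_iso_def
    by (rule exI[of _ "\<lambda>a x. x"]) (auto simp: pers_morphism_def linear_on_def bij_betw_def)
  then show "refl_on {M :: 'k pmodule. persistence_module M} iso_rel"
    by (auto simp: refl_on_def iso_rel_def)
  show "sym (iso_rel :: ('k pmodule \<times> _) set)"
  proof (rule symI)
    fix M N :: "'k pmodule" assume "(M, N) \<in> iso_rel"
    then obtain f where f: "persistence_module M" "persistence_module N" "pers_morphism M N f"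
        "\<forall>a. bij_betw (f a) (pspace M a) (pspace N a)"
      by (auto simp: iso_rel_def pers_iso_def)
    have "\<forall>a. bij_betw (inv_into (pspace M a) (f a)) (pspace N a) (pspace M a)"
      using f(4) by (simp add: bij_betw_inv_into)
    with pers_iso_inverse[OF f(3,4,1)] have "pers_iso N M"
      unfolding pers_iso_def by (intro exI conjI)
    with f(1,2) show "(N, M) \<in> iso_rel"
      by (simp add: iso_rel_def)
  qed
  show "trans (iso_rel :: ('k pmodule \<times> _) set)"
  proof (rule transI)
    fix L M N :: "'k pmodule" assume "(L, M) \<in> iso_rel" "(M, N) \<in> iso_rel"
    then obtain f g where *: "persistence_module L" "persistence_module N"
        "pers_morphism L M f" "pers_morphism M N g"
        "\<forall>a. bij_betw (f a) (pspace L a) (pspace M a)"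
        "\<forall>a. bij_betw (g a) (pspace M a) (pspace N a)"
      by (auto simp: iso_rel_def pers_iso_def)
    have "\<forall>a. bij_betw (\<lambda>x. g a (f a x)) (pspace L a) (pspace N a)"
      using bij_betw_trans[OF *(5)[rule_format] *(6)[rule_format]] by (simp add: comp_def)
    with pers_morphism_compose[OF *(3,4)] have "pers_iso L N"
      unfolding pers_iso_def by (intro exI conjI)
    with *(1,2) show "(L, N) \<in> iso_rel"
      by (simp add: iso_rel_def)
  qed
qed

lemma interleaved_sym: "interleaved \<epsilon> M N \<Longrightarrow> interleaved \<epsilon> N M"
  unfolding interleaved_def by blast

lemma interleaved_iso:
  assumes "(M, M') \<in> iso_rel" "interleaved \<epsilon> M N" "0 \<le> \<epsilon>"
  shows "interleaved \<epsilon> M' N"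
proof -
  obtain f where f: "persistence_module M" "pers_morphism M M' f"
      "\<forall>a. bij_betw (f a) (pspace M a) (pspace M' a)"
    using assms(1) by (auto simp: iso_rel_def pers_iso_def)
  define g where "g = (\<lambda>a. inv_into (pspace M a) (f a))"
  have g: "pers_morphism M' M g"
    unfolding g_def by (rule pers_iso_inverse[OF f(2,3,1)])
  have fg: "f a (g a y) = y" if "y \<in> pspace M' a" for a y
    unfolding g_def by (rule bij_betw_inv_into_right[OF f(3)[rule_format] that])
  have gf: "g a (f a x) = x" if "x \<in> pspace M a" for a x
    unfolding g_def by (rule bij_betw_inv_into_left[OF f(3)[rule_format] that])
  have gmem: "g a y \<in> pspace M a" if "y \<in> pspace M' a" for a y
    using g that unfolding pers_morphism_def linear_on_def image_subset_iff by simp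
  obtain \<phi> \<psi> where *: "pers_morphism M (shift \<epsilon> N) \<phi>" "pers_morphism N (shift \<epsilon> M) \<psi>"
      "\<forall>a. \<forall>x\<in>pspace M a. \<psi> (a + \<epsilon>) (\<phi> a x) = pmap M a (a + 2 * \<epsilon>) x"
      "\<forall>a. \<forall>y\<in>pspace N a. \<phi> (a + \<epsilon>) (\<psi> a y) = pmap N a (a + 2 * \<epsilon>) y"
    using assms(2) unfolding interleaved_def by blast
  have \<psi>mem: "\<psi> a y \<in> pspace M (a + \<epsilon>)" if "y \<in> pspace N a" for a y
    using *(2) that unfolding pers_morphism_def linear_on_def image_subset_iff shift_def by simp
  show ?thesis
    unfolding interleaved_def
  proof (intro exI conjI allI ballI)
    show "pers_morphism M' (shift \<epsilon> N) (\<lambda>a x. \<phi> a (g a x))"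
      by (rule pers_morphism_compose[OF g *(1)])
    show "pers_morphism N (shift \<epsilon> M') (\<lambda>a x. f (a + \<epsilon>) (\<psi> a x))"
      by (rule pers_morphism_compose[OF *(2) pers_morphism_shift[OF f(2)]])
  next
    fix a x assume x: "x \<in> pspace M' a"
    have "f (a + \<epsilon> + \<epsilon>) (\<psi> (a + \<epsilon>) (\<phi> a (g a x))) = f (a + 2 * \<epsilon>) (pmap M a (a + 2 * \<epsilon>) (g a x))"
      using *(3) gmem[OF x] by (simp add: add.assoc)
    also have "\<dots> = pmap M' a (a + 2 * \<epsilon>) (f a (g a x))"
      using f(2) gmem[OF x] assms(3) by (simp add: pers_morphism_def)
    finally show "f (a + \<epsilon> + \<epsilon>) (\<psi> (a + \<epsilon>) (\<phi> a (g a x))) = pmap M' a (a + 2 * \<epsilon>) x"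
      using fg[OF x] by simp
  next
    fix a y assume y: "y \<in> pspace N a"
    show "\<phi> (a + \<epsilon>) (g (a + \<epsilon>) (f (a + \<epsilon>) (\<psi> a y))) = pmap N a (a + 2 * \<epsilon>) y"
      using *(4) y gf[OF \<psi>mem[OF y]] by simp
  qed
qed

lemma interleaving_dist_iso:
  assumes "(M, M') \<in> iso_rel" "(N, N') \<in> iso_rel"
  shows "interleaving_dist M' N' = interleaving_dist M N"
proof -
  have "(M', M) \<in> iso_rel" "(N', N) \<in> iso_rel"
    using assms equiv_iso_rel by (meson equivE symE)+
  with assms have "0 \<le> \<epsilon> \<and> interleaved \<epsilon> M' N' \<longleftrightarrow> 0 \<le> \<epsilon> \<and> interleaved \<epsilon> M N" for \<epsilon>
    by (meson interleaved_iso interleaved_sym)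
  then show ?thesis
    by (simp add: interleaving_dist_def)
qed

theorem class_dist_iso_class:
  assumes "persistence_module M" "persistence_module N"
  shows "class_dist (iso_class M) (iso_class N) = interleaving_dist M N"
proof -
  have ne: "iso_class M \<noteq> {}" "iso_class N \<noteq> {}"
    using assms equiv_class_self[OF equiv_iso_rel] by (auto simp: iso_class_def)
  have "interleaving_dist M' N' = interleaving_dist M N"
    if "M' \<in> iso_class M" "N' \<in> iso_class N" for M' N'
    using that interleaving_dist_iso by (auto simp: iso_class_def)
  then have "class_dist (iso_class M) (iso_class N) =
      (INF M'\<in>iso_class M. INF N'\<in>iso_class N. interleaving_dist M N)"
    unfolding class_dist_def by (intro INF_cong refl) simp
  then show ?thesis
    using ne by simp
qed

end

theory Submission
  imports Defs
begin

text \<open>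
  The two open inclusions hold because boundedness of intervals is rigid: a direct sum of bounded
  intervals is at infinite distance from every direct sum with an unbounded interval
  (\<open>not_interleaved_unbounded\<close>). Each nonzero element of the first module has finite support, so
  it dies after finite time and does not come from arbitrarily far back. The generator of an unbounded
  interval lives forever or comes from arbitrarily far back, and an interleaving would carry this
  property over. Hence every ball around a class with bounded intervals consists of such classes.

  For the six other inclusions, one-point intervals suffice. In a direct sum of one-point intervals
  all structure maps between distinct parameters vanish, so it is at distance \<open>0\<close> from the zero
  module, and no open set separates the two (\<open>openin_dI_topology_zero_module\<close>). Thus an open set
  containing the zero module contains all those sums in the ambient space. The zero module lies in
  each of the six subspaces, and the following sums do not:
  \<^item> the point \<open>d + 1\<close>, which is not contained in \<open>{c..d}\<close>;
  \<^item> countably infinitely many copies of the point \<open>0\<close>, which have infinite dimension at \<open>0\<close>, so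
    that this sum is in none of \<open>ffid\<close>, \<open>fid\<close> and \<open>pfd\<close>;
  \<^item> continuum many copies of the point \<open>0\<close>, which have uncountable dimension at \<open>0\<close>;
  \<^item> the points of \<open>\<nat>\<close>, one copy each, a pointwise finite-dimensional module that is nonzero at
    every natural number while its structure maps from \<open>n\<close> to \<open>n + 1\<close> vanish; a finite direct sum
    cannot do this, because an interval contains at most one natural \<open>n\<close> without \<open>n + 1\<close>.

  Membership of classes is decided by two isomorphism invariants: which structure maps
  vanish, and how many elements it takes to span the space at a given parameter.
\<close>

section \<open>Elements and spanning sets of direct sums of intervals\<close>

lemma in_pspace_interval_sum:
  "f \<in> pspace (interval_sum A J :: 'k::field pmodule) a \<longleftrightarrow>
     finite {i. f i \<noteq> 0} \<and> (\<forall>i. f i \<noteq> 0 \<longrightarrow> i \<in> A \<and> a \<in> J i)"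
  by (auto simp: interval_sum_def direct_sum_def interval_module_def split: if_splits)

lemma pmap_interval_sum:
  "pmap (interval_sum A J :: 'k::field pmodule) a b f =
     (\<lambda>i. if i \<in> A \<and> a \<in> J i \<and> b \<in> J i then f i else 0)"
  by (auto simp: interval_sum_def direct_sum_def interval_module_def)

lemma indicator_in_pspace_interval_sum:
  "i \<in> A \<Longrightarrow> a \<in> J i \<Longrightarrow> indicator {i} \<in> pspace (interval_sum A J :: 'k::field pmodule) a"
  by (auto simp: in_pspace_interval_sum indicator_def)

lemma subspace_pspace_interval_sum:
  assumes "\<forall>i\<in>A. real_interval (J i)"
  shows "fv.subspace (pspace (interval_sum A J :: 'k::field pmodule) a)"
  using persistence_module_interval_sum[OF assms, where 'k = 'k] by (simp add: persistence_module_def)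

lemma sum_fun_apply: "(\<Sum>i\<in>S. g i) x = (\<Sum>i\<in>S. g i x)"
  for g :: "'i \<Rightarrow> 'a \<Rightarrow> 'b::comm_monoid_add"
  by (induction S rule: infinite_finite_induct) auto

lemma span_indicators:
  assumes "\<forall>i\<in>A. real_interval (J i)"
  shows "fv.span ((\<lambda>i. indicator {i}) ` {i\<in>A. a \<in> J i}) =
    pspace (interval_sum A J :: 'k::field pmodule) a" (is "fv.span ?E = ?V")
proof (rule fv.span_eq_iff[THEN iffD2, THEN subst])
  show "fv.subspace ?V"
    by (rule subspace_pspace_interval_sum[OF assms])
  show "fv.span ?E = fv.span ?V"
  proof (rule fv.span_eq[THEN iffD2], intro conjI subsetI)
    fix f assume "f \<in> ?E"
    then show "f \<in> fv.span ?V"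
      by (auto intro!: fv.span_base indicator_in_pspace_interval_sum)
  next
    fix f assume f: "f \<in> ?V"
    have fin: "finite {i. f i \<noteq> 0}"
      using f by (simp add: in_pspace_interval_sum)
    have "f = (\<Sum>i\<in>{i. f i \<noteq> 0}. fscale (f i) (indicator {i}))"
    proof
      fix x
      have "(\<Sum>i\<in>{i. f i \<noteq> 0}. fscale (f i) (indicator {i})) x =
          (\<Sum>i\<in>{i. f i \<noteq> 0}. if i = x then f i else 0)"
        unfolding sum_fun_apply by (rule sum.cong) (auto simp: fscale_def)
      then show "f x = (\<Sum>i\<in>{i. f i \<noteq> 0}. fscale (f i) (indicator {i})) x"
        using fin by (simp add: sum.delta)
    qed
    also have "\<dots> \<in> fv.span ?E"
      using f by (intro fv.span_sum fv.span_scale fv.span_base) (auto simp: in_pspace_interval_sum)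
    finally show "f \<in> fv.span ?E" .
  qed
qed

text \<open>
  At an index outside the supports of all spanning vectors every linear combination vanishes, but
  the generator of that index does not. Since all supports are finite, this turns the size of a
  spanning set into a bound on the number of intervals at \<open>a\<close>.
\<close>

lemma spanning_set_covers_indices:
  assumes "fv.span B = pspace (interval_sum A J :: 'k::field pmodule) a"
  shows "{i\<in>A. a \<in> J i} \<subseteq> (\<Union>f\<in>B. {i. f i \<noteq> 0})"
proof
  fix i assume "i \<in> {i\<in>A. a \<in> J i}"
  then have i: "indicator {i} \<in> fv.span B"
    using assms indicator_in_pspace_interval_sum by auto
  show "i \<in> (\<Union>f\<in>B. {i. f i \<noteq> 0})"
  proof (rule ccontr)
    assume *: "i \<notin> (\<Union>f\<in>B. {i. f i \<noteq> 0})"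
    have "fv.subspace {f :: real \<Rightarrow> 'k. f i = 0}"
      by (auto simp: fv.subspace_def fscale_def)
    then have "fv.span B \<subseteq> {f. f i = 0}"
      using * by (intro fv.span_minimal) auto
    then show False
      using i by auto
  qed
qed

lemma finite_support_of_spanning_set:
  assumes "fv.span B = pspace (interval_sum A J :: 'k::field pmodule) a" "f \<in> B"
  shows "finite {i. f i \<noteq> 0}"
  using fv.span_base[OF assms(2)] assms(1) by (simp add: in_pspace_interval_sum)


lemma real_interval_singleton: "real_interval {p}"
  by (auto simp: real_interval_def is_interval_1)


section \<open>Isomorphism invariants\<close>

definition zero_map :: "'k::field pmodule \<Rightarrow> real \<Rightarrow> real \<Rightarrow> bool" where
  "zero_map M a b \<longleftrightarrow> (\<forall>x\<in>pspace M a. pmap M a b x = 0)"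

lemma zero_map_interval_sum_iff:
  "zero_map (interval_sum A J :: 'k::field pmodule) a b \<longleftrightarrow> (\<forall>i\<in>A. \<not> (a \<in> J i \<and> b \<in> J i))"
proof
  assume *: "zero_map (interval_sum A J :: 'k pmodule) a b"
  show "\<forall>i\<in>A. \<not> (a \<in> J i \<and> b \<in> J i)"
  proof (intro ballI notI)
    fix i assume i: "i \<in> A" "a \<in> J i \<and> b \<in> J i"
    then have "pmap (interval_sum A J :: 'k pmodule) a b (indicator {i}) = 0"
      using * indicator_in_pspace_interval_sum[where 'k = 'k] by (simp add: zero_map_def)
    from fun_cong[OF this, of i] i show False
      by (simp add: pmap_interval_sum)
  qed
qed (auto simp: zero_map_def pmap_interval_sum fun_eq_iff)

lemma linear_on_zero:
  assumes "linear_on S T f" "0 \<in> S"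
  shows "f 0 = 0"
proof -
  have "f (0 + 0) = f 0 + f 0"
    using assms unfolding linear_on_def by blast
  then show ?thesis
    by simp
qed

lemma zero_in_pspace: "persistence_module M \<Longrightarrow> 0 \<in> pspace M a"
  by (auto simp: persistence_module_def fv.subspace_0)

lemma pmap_zero: "persistence_module M \<Longrightarrow> a \<le> b \<Longrightarrow> pmap M a b 0 = 0"
  by (rule linear_on_zero[where S = "pspace M a" and T = "pspace M b"])
    (simp_all add: persistence_module_def fv.subspace_0)

lemma pers_morphism_in_pspace:
  "pers_morphism M N f \<Longrightarrow> x \<in> pspace M a \<Longrightarrow> f a x \<in> pspace N a"
  by (simp add: pers_morphism_def linear_on_def image_subset_iff)

lemma pers_morphism_zero:
  "pers_morphism M N f \<Longrightarrow> persistence_module M \<Longrightarrow> f a 0 = 0"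
  by (rule linear_on_zero[where S = "pspace M a" and T = "pspace N a"])
    (simp_all add: pers_morphism_def zero_in_pspace)

lemma zero_map_iso:
  assumes "(M, N) \<in> iso_rel" "a \<le> b" "zero_map M a b"
  shows "zero_map N a b"
proof -
  obtain f where f: "persistence_module M" "pers_morphism M N f"
      "\<forall>a. bij_betw (f a) (pspace M a) (pspace N a)"
    using assms(1) by (auto simp: iso_rel_def pers_iso_def)
  have "pmap N a b y = 0" if "y \<in> pspace N a" for y
  proof -
    have "pspace N a = f a ` pspace M a"
      by (rule bij_betw_imp_surj_on[OF f(3)[rule_format], symmetric])
    with that obtain x where x: "x \<in> pspace M a" "y = f a x"
      by blast
    then have "pmap N a b y = f b (pmap M a b x)"
      using f(2) assms(2) by (simp add: pers_morphism_def)
    also have "f b (pmap M a b x) = f b 0"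
      using x(1) assms(3) by (simp add: zero_map_def)
    also have "f b 0 = 0"
      by (rule pers_morphism_zero[OF f(2,1)])
    finally show ?thesis .
  qed
  then show ?thesis
    by (simp add: zero_map_def)
qed

lemma span_image_linear_on:
  assumes "linear_on (fv.span B) T f"
  shows "f ` fv.span B = fv.span (f ` B)"
proof -
  have add: "f (x + y) = f x + f y" if "x \<in> fv.span B" "y \<in> fv.span B" for x y
    using assms that by (simp add: linear_on_def)
  have scale: "f (fscale r x) = fscale r (f x)" if "x \<in> fv.span B" for r x
    using assms that by (simp add: linear_on_def)
  have zero: "f 0 = 0"
    by (rule linear_on_zero[OF assms fv.span_zero])
  have sub1: "fv.subspace {x \<in> fv.span B. f x \<in> fv.span (f ` B)}"
    by (auto simp: fv.subspace_def add scale zero fv.span_add fv.span_scale fv.span_zero)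
  have "fv.span B \<subseteq> {x \<in> fv.span B. f x \<in> fv.span (f ` B)}"
    by (rule fv.span_minimal[OF _ sub1]) (auto intro: fv.span_base)
  moreover have "fv.subspace (f ` fv.span B)"
    unfolding fv.subspace_def
  proof (intro conjI ballI allI)
    show "0 \<in> f ` fv.span B"
      by (rule image_eqI[where x = 0]) (simp_all add: zero fv.span_zero)
  next
    fix x y assume "x \<in> f ` fv.span B" "y \<in> f ` fv.span B"
    then obtain u v where "u \<in> fv.span B" "v \<in> fv.span B" "x = f u" "y = f v"
      by blast
    then show "x + y \<in> f ` fv.span B"
      by (intro image_eqI[where x = "u + v"]) (simp_all add: add fv.span_add)
  next
    fix r x assume "x \<in> f ` fv.span B"
    then obtain u where "u \<in> fv.span B" "x = f u"
      by blast
    then show "fscale r x \<in> f ` fv.span B"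
      by (intro image_eqI[where x = "fscale r u"]) (simp_all add: scale fv.span_scale)
  qed
  then have "fv.span (f ` B) \<subseteq> f ` fv.span B"
    by (intro fv.span_minimal image_mono fv.span_superset)
  ultimately show ?thesis
    by auto
qed

lemma spanning_set_iso:
  assumes "(M, N) \<in> iso_rel" "fv.span B = pspace M a"
  obtains f where "fv.span (f ` B) = pspace N a"
proof -
  obtain f where "pers_morphism M N f" "\<forall>a. bij_betw (f a) (pspace M a) (pspace N a)"
    using assms(1) by (auto simp: iso_rel_def pers_iso_def)
  then have f: "linear_on (pspace M a) (pspace N a) (f a)"
      "bij_betw (f a) (pspace M a) (pspace N a)"
    by (simp_all add: pers_morphism_def)
  have "fv.span (f a ` B) = pspace N a"
    using span_image_linear_on[of B "pspace N a" "f a"] f assms(2)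
    by (simp add: bij_betw_imp_surj_on)
  then show thesis
    by (rule that)
qed

lemma iso_class_eqD:
  assumes "iso_class M = iso_class N" "persistence_module M" "persistence_module N"
  shows "(M, N) \<in> iso_rel"
  using assms eq_equiv_class[OF _ equiv_iso_rel] by (auto simp: iso_class_def)


section \<open>Modules at distance zero from the zero module\<close>

abbreviation zero_module :: "'k::field pmodule" where
  "zero_module \<equiv> interval_sum {} (\<lambda>_. {})"

abbreviation (input) pers_classes :: "'k::field pclass set" where
  "pers_classes \<equiv> iso_class ` {M. persistence_module M}"

lemma persistence_module_zero_module: "persistence_module (zero_module :: 'k::field pmodule)"
  by (rule persistence_module_interval_sum) simp

lemma interleaved_by_zero:
  assumes "persistence_module M" "persistence_module N"
    and "\<forall>a. zero_map M a (a + 2 * \<epsilon>)" "\<forall>a. zero_map N a (a + 2 * \<epsilon>)"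
  shows "interleaved \<epsilon> M N"
  unfolding interleaved_def
proof (intro exI conjI)
  have fscale_zero: "fscale r 0 = (0 :: real \<Rightarrow> 'a)" for r
    by simp
  have "pers_morphism K (shift \<epsilon> L) (\<lambda>a x. 0)" if "persistence_module L"
    for K L :: "'a pmodule"
    using that by (auto simp: pers_morphism_def linear_on_def shift_def zero_in_pspace pmap_zero fscale_zero)
  then show "pers_morphism M (shift \<epsilon> N) (\<lambda>a x. 0)" "pers_morphism N (shift \<epsilon> M) (\<lambda>a x. 0)"
    using assms by auto
qed (use assms in \<open>auto simp: zero_map_def\<close>)

lemma zero_map_if_interleaved_zero_module:
  assumes "interleaved \<epsilon> M zero_module" "persistence_module M"
  shows "zero_map M a (a + 2 * \<epsilon>)"
proof -
  obtain \<phi> \<psi> where *: "pers_morphism M (shift \<epsilon> zero_module) \<phi>"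
      "pers_morphism zero_module (shift \<epsilon> M) \<psi>"
      "\<forall>a. \<forall>x\<in>pspace M a. \<psi> (a + \<epsilon>) (\<phi> a x) = pmap M a (a + 2 * \<epsilon>) x"
    using assms(1) unfolding interleaved_def by blast
  have "\<phi> a x = 0" if "x \<in> pspace M a" for x
  proof -
    have "\<phi> a x \<in> pspace zero_module (a + \<epsilon>)"
      using pers_morphism_in_pspace[OF *(1) that] by (simp add: shift_def)
    then show ?thesis
      by (auto simp: in_pspace_interval_sum fun_eq_iff)
  qed
  moreover have "\<psi> (a + \<epsilon>) 0 = 0"
    by (rule pers_morphism_zero[OF *(2) persistence_module_zero_module])
  ultimately show ?thesis
    using *(3) by (metis zero_map_def)
qed

text \<open>
  An \<open>\<epsilon>\<close>-interleaving with the zero module forces the structure maps of length \<open>2\<epsilon>\<close> to vanish.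
  Then, for every \<open>\<eta> > \<epsilon>\<close>, zero maps interleave with any module whose structure maps of positive
  length vanish. Since \<open>\<epsilon> < r\<close>, such an \<open>\<eta>\<close> still fits below \<open>r\<close>.
\<close>

lemma interleaving_dist_less_ephemeral:
  assumes "persistence_module M" "persistence_module N" "\<forall>a b. a < b \<longrightarrow> zero_map N a b"
    and "interleaving_dist M zero_module < ereal r"
  shows "interleaving_dist M N < ereal r"
proof -
  obtain \<epsilon> where \<epsilon>: "0 \<le> \<epsilon>" "interleaved \<epsilon> M zero_module" "\<epsilon> < r"
    using assms(4) by (auto simp: interleaving_dist_def Inf_less_iff)
  define \<eta> where "\<eta> = (\<epsilon> + r) / 2"
  have \<eta>: "\<epsilon> < \<eta>" "\<eta> < r"
    using \<epsilon> by (auto simp: \<eta>_def)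
  have "zero_map M a (a + 2 * \<eta>)" for a
    unfolding zero_map_def
  proof
    fix x assume x: "x \<in> pspace M a"
    have "pmap M a (a + 2 * \<eta>) x = pmap M (a + 2 * \<epsilon>) (a + 2 * \<eta>) (pmap M a (a + 2 * \<epsilon>) x)"
      using assms(1) x \<epsilon> \<eta> by (simp add: persistence_module_def)
    also have "\<dots> = 0"
      using zero_map_if_interleaved_zero_module[OF \<epsilon>(2) assms(1)] x assms(1) \<eta>
      by (simp add: zero_map_def pmap_zero)
    finally show "pmap M a (a + 2 * \<eta>) x = 0" .
  qed
  moreover have "\<forall>a. zero_map N a (a + 2 * \<eta>)"
    using assms(3) \<epsilon> \<eta> by simp
  ultimately have "interleaved \<eta> M N"
    using assms by (intro interleaved_by_zero) auto
  then have "interleaving_dist M N \<le> ereal \<eta>"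
    unfolding interleaving_dist_def using \<epsilon> \<eta> by (intro Inf_lower) auto
  then show ?thesis
    using \<eta> by (meson ereal_less_eq le_less_trans less_ereal.simps(1))
qed

lemma openin_generated_specialization:
  assumes "openin (topology_generated_by S) U" "x \<in> U"
    and "\<And>B. B \<in> S \<Longrightarrow> x \<in> B \<Longrightarrow> y \<in> B"
  shows "y \<in> U"
proof -
  have "generate_topology_on S U"
    using assms(1) by (simp add: openin_topology_generated_by)
  then show ?thesis
    using assms(2)
  proof induction
    case (Int a b)
    then show ?case
      by simp
  next
    case (UN K)
    then obtain k where "k \<in> K" "x \<in> k"
      by blast
    then show ?case
      using UN.IH by blast
  next
    case (Basis s)
    then show ?case
      by (intro assms(3))
  qed simp
qed

text \<open>
  No ball contains the zero module without containing the given sum, so the sum belongs to every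
  open neighbourhood of the zero module.
\<close>

lemma openin_dI_topology_zero_module:
  fixes Y :: "'k::field pclass set"
  assumes "openin (dI_topology Y) U" "iso_class zero_module \<in> U" "Y \<subseteq> pers_classes"
    and "\<forall>i\<in>A. J i = {p i}" "iso_class (interval_sum A J) \<in> Y"
  shows "iso_class (interval_sum A J) \<in> U"
proof (rule openin_generated_specialization[OF assms(1)[unfolded dI_topology_def] assms(2)])
  fix B assume B: "B \<in> {dI_ball Y P r |P r. P \<in> Y \<and> 0 < r}" "iso_class zero_module \<in> B"
  then obtain P r where P: "B = dI_ball Y P r" "P \<in> Y"
    by auto
  then obtain M where M: "P = iso_class M" "persistence_module M"
    using assms(3) by blast
  have N: "persistence_module (interval_sum A J :: 'k pmodule)"
    using assms(4) by (intro persistence_module_interval_sum) (simp add: real_interval_singleton)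
  have "class_dist P (iso_class zero_module) < ereal r"
    using B(2) P(1) by (simp add: dI_ball_def)
  then have dist: "interleaving_dist M zero_module < ereal r"
    unfolding M(1) class_dist_iso_class[OF M(2) persistence_module_zero_module] .
  have "\<forall>a b. a < b \<longrightarrow> zero_map (interval_sum A J :: 'k pmodule) a b"
    using assms(4) by (simp add: zero_map_interval_sum_iff)
  then have "interleaving_dist M (interval_sum A J) < ereal r"
    by (rule interleaving_dist_less_ephemeral[OF M(2) N _ dist])
  then have "class_dist P (iso_class (interval_sum A J)) < ereal r"
    unfolding M(1) class_dist_iso_class[OF M(2) N] .
  then show "iso_class (interval_sum A J) \<in> B"
    unfolding P(1) dI_ball_def using assms(5) by blast
qed

lemma not_openin_dI_topology:
  fixes Y :: "'k::field pclass set"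
  assumes "iso_class zero_module \<in> U" "Y \<subseteq> pers_classes"
    and "\<forall>i\<in>A. J i = {p i}" "iso_class (interval_sum A J) \<in> Y"
    and "iso_class (interval_sum A J) \<notin> U"
  shows "\<not> openin (dI_topology Y) U"
  using openin_dI_topology_zero_module[OF _ assms(1-4)] assms(5) by blast


section \<open>Bounded and unbounded intervals\<close>

lemma unbounded_real_intervalE:
  assumes "real_interval K" "\<not> bounded K"
  obtains s where "s \<in> K" "{s..} \<subseteq> K" | s where "s \<in> K" "{..s} \<subseteq> K"
proof -
  obtain s where s: "s \<in> K"
    using assms(1) unfolding real_interval_def by blast
  have mid: "y \<in> K" if "x \<in> K" "z \<in> K" "x \<le> y" "y \<le> z" for x y z
    using assms(1) that unfolding real_interval_def is_interval_1 by blast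
  show thesis
  proof (cases "bdd_above K")
    case True
    then have "\<not> bdd_below K"
      using assms(2) bounded_subset[OF bounded_closed_interval] unfolding bdd_above_def bdd_below_def
      by (metis atLeastAtMost_iff subsetI)
    then have "{..s} \<subseteq> K"
      using mid s by (meson atMost_iff bdd_below.I linear subsetI)
    then show thesis
      using s that by blast
  next
    case False
    then have "{s..} \<subseteq> K"
      using mid s by (meson atLeast_iff bdd_above.I linear subsetI)
    then show thesis
      using s that by blast
  qed
qed

lemma not_interleaved_unbounded:
  assumes A: "\<forall>i\<in>A. real_interval (J i) \<and> bounded (J i)"
    and B: "\<forall>i\<in>B. real_interval (K i)" and k: "k \<in> B" "\<not> bounded (K k)" and "0 \<le> \<epsilon>"
  shows "\<not> interleaved \<epsilon> (interval_sum A J :: 'k::field pmodule) (interval_sum B K)"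
proof
  let ?M = "interval_sum A J :: 'k pmodule" and ?N = "interval_sum B K :: 'k pmodule"
  let ?y = "indicator {k} :: real \<Rightarrow> 'k"
  assume "interleaved \<epsilon> ?M ?N"
  then obtain \<phi> \<psi> where \<phi>: "pers_morphism ?M (shift \<epsilon> ?N) \<phi>"
      and \<psi>: "pers_morphism ?N (shift \<epsilon> ?M) \<psi>"
      and \<phi>\<psi>: "\<And>a y. y \<in> pspace ?N a \<Longrightarrow> \<phi> (a + \<epsilon>) (\<psi> a y) = pmap ?N a (a + 2 * \<epsilon>) y"
    unfolding interleaved_def by blast
  have M: "persistence_module ?M"
    using A by (intro persistence_module_interval_sum) auto
  have \<phi>0: "\<phi> a 0 = 0" for a
    by (rule pers_morphism_zero[OF \<phi> M])
  have \<psi>_in: "\<psi> a y \<in> pspace ?M (a + \<epsilon>)" if "y \<in> pspace ?N a" for a y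
    using pers_morphism_in_pspace[OF \<psi> that] by (simp add: shift_def)
  have y_in: "?y \<in> pspace ?N a" if "a \<in> K k" for a
    using k that by (intro indicator_in_pspace_interval_sum)
  have y_map: "pmap ?N a b ?y = ?y" if "a \<in> K k" "b \<in> K k" for a b
    using k that by (auto simp: pmap_interval_sum indicator_def)
  have y0: "0 \<noteq> ?y"
    by (metis indicator_simps(1) singletonI zero_fun_apply zero_neq_one)
  have supp: "\<exists>R. \<forall>i t. z i \<noteq> 0 \<longrightarrow> t \<in> J i \<longrightarrow> \<bar>t\<bar> \<le> R" if "z \<in> pspace ?M a" for z a
  proof -
    have "bounded (\<Union>i\<in>{i. z i \<noteq> 0}. J i)"
      using that A by (intro bounded_UN) (auto simp: in_pspace_interval_sum)
    then show ?thesis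
      by (auto simp: bounded_iff)
  qed
  show False
    using B[rule_format, OF k(1)] k(2)
  proof (cases rule: unbounded_real_intervalE)
    \<comment> \<open>The generator lives forever, but its image under \<open>\<psi>\<close> dies.\<close>
    case (1 s)
    define z where "z = \<psi> s ?y"
    have z: "z \<in> pspace ?M (s + \<epsilon>)"
      unfolding z_def by (intro \<psi>_in y_in 1)
    obtain R where R: "\<And>i t. z i \<noteq> 0 \<Longrightarrow> t \<in> J i \<Longrightarrow> \<bar>t\<bar> \<le> R"
      using supp[OF z] by blast
    \<comment> \<open>At time \<open>u\<close> all intervals in the support of \<open>z\<close> have ended.\<close>
    define u where "u = max (s + \<epsilon>) (R + 1)"
    have u: "s + \<epsilon> \<le> u"
      by (simp add: u_def)
    have "pmap ?M (s + \<epsilon>) u z = 0"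
      using R[of _ u] by (force simp: pmap_interval_sum fun_eq_iff u_def)
    then have "0 = \<phi> u (pmap ?M (s + \<epsilon>) u z)"
      by (simp add: \<phi>0)
    also have "\<dots> = pmap ?N (s + \<epsilon> + \<epsilon>) (u + \<epsilon>) (\<phi> (s + \<epsilon>) z)"
      using \<phi> z u by (simp add: pers_morphism_def shift_def)
    also have "\<phi> (s + \<epsilon>) z = pmap ?N s (s + 2 * \<epsilon>) ?y"
      unfolding z_def by (intro \<phi>\<psi> y_in 1)
    also have "\<dots> = ?y"
      using 1 \<open>0 \<le> \<epsilon>\<close> by (intro y_map) auto
    also have "pmap ?N (s + \<epsilon> + \<epsilon>) (u + \<epsilon>) ?y = ?y"
      using 1 \<open>0 \<le> \<epsilon>\<close> u by (intro y_map) auto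
    finally show False
      by (rule notE[OF y0])
  next
    \<comment> \<open>The generator comes from arbitrarily far back, which leaves only \<open>0\<close> for its image.\<close>
    case (2 s)
    define z where "z = \<psi> (s - 2 * \<epsilon>) ?y"
    have s: "s - 2 * \<epsilon> \<in> K k"
      using 2 \<open>0 \<le> \<epsilon>\<close> by auto
    have z: "z \<in> pspace ?M (s - 2 * \<epsilon> + \<epsilon>)"
      unfolding z_def by (intro \<psi>_in y_in s)
    obtain R where R: "\<And>i t. z i \<noteq> 0 \<Longrightarrow> t \<in> J i \<Longrightarrow> \<bar>t\<bar> \<le> R"
      using supp[OF z] by blast
    \<comment> \<open>At time \<open>t + \<epsilon>\<close> no interval in the support of \<open>z\<close> has begun.\<close>
    define t where "t = min (s - 2 * \<epsilon>) (- R - 1 - \<epsilon>)"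
    have t: "t \<le> s - 2 * \<epsilon>" "t + \<epsilon> < - R"
      by (auto simp: t_def)
    have tK: "t \<in> K k"
      using t 2 \<open>0 \<le> \<epsilon>\<close> by auto
    have "z = \<psi> (s - 2 * \<epsilon>) (pmap ?N t (s - 2 * \<epsilon>) ?y)"
      unfolding z_def using tK s by (simp add: y_map)
    also have "\<dots> = pmap ?M (t + \<epsilon>) (s - 2 * \<epsilon> + \<epsilon>) (\<psi> t ?y)"
      using \<psi> t y_in[OF tK] by (simp add: pers_morphism_def shift_def)
    finally have "z i \<noteq> 0 \<Longrightarrow> t + \<epsilon> \<in> J i" for i
      by (metis pmap_interval_sum)
    then have "z = 0"
      using R[of _ "t + \<epsilon>"] t by (force simp: fun_eq_iff)
    then have "0 = \<phi> (s - 2 * \<epsilon> + \<epsilon>) z"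
      by (simp add: \<phi>0)
    also have "\<dots> = pmap ?N (s - 2 * \<epsilon>) (s - 2 * \<epsilon> + 2 * \<epsilon>) ?y"
      unfolding z_def by (intro \<phi>\<psi> y_in s)
    also have "\<dots> = ?y"
      using 2 s by (intro y_map) auto
    finally show False
      by (rule notE[OF y0])
  qed
qed

lemma interleaving_dist_self:
  assumes "persistence_module M"
  shows "interleaving_dist M M \<le> 0"
proof -
  have id: "pmap M a a x = x" if "x \<in> pspace M a" for a x
    using assms that unfolding persistence_module_def by blast
  have "shift 0 M = M"
    by (simp add: shift_def)
  moreover have "pers_morphism M M (\<lambda>a x. x)"
    by (simp add: pers_morphism_def linear_on_def)
  ultimately have "interleaved 0 M M"
    unfolding interleaved_def by (intro exI[of _ "\<lambda>a x. x"]) (simp add: id)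
  then show ?thesis
    unfolding interleaving_dist_def zero_ereal_def by (intro Inf_lower) auto
qed

lemma openin_dI_topologyI:
  fixes Y :: "'k::field pclass set"
  assumes "U \<subseteq> Y" "Y \<subseteq> pers_classes"
    and "\<And>P. P \<in> U \<Longrightarrow> dI_ball Y P 1 \<subseteq> U"
  shows "openin (dI_topology Y) U"
proof -
  have "P \<in> dI_ball Y P 1" if P: "P \<in> U" for P
  proof -
    obtain M where "P = iso_class M" "persistence_module M"
      using assms(1,2) P by blast
    then have "class_dist P P \<le> 0"
      by (simp add: class_dist_iso_class interleaving_dist_self)
    then have "class_dist P P < ereal 1"
      by (rule le_less_trans) simp
    then show ?thesis
      using P assms(1) unfolding dI_ball_def by blast
  qed
  then have "U = (\<Union>P\<in>U. dI_ball Y P 1)"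
    using assms(3) by blast
  moreover have "openin (dI_topology Y) (dI_ball Y P 1)" if "P \<in> U" for P
    unfolding dI_topology_def using that assms(1) by (intro topology_generated_by_Basis) force
  ultimately show ?thesis
    by (metis (no_types, lifting) imageE openin_Union)
qed

lemma bounded_if_class_dist_finite:
  assumes "\<forall>i\<in>A. real_interval (J i) \<and> bounded (J i)" "\<forall>i\<in>B. real_interval (K i)"
    and "class_dist (iso_class (interval_sum A J :: 'k::field pmodule))
           (iso_class (interval_sum B K)) < ereal r"
  shows "\<forall>i\<in>B. bounded (K i)"
proof (rule ccontr)
  assume "\<not> (\<forall>i\<in>B. bounded (K i))"
  then obtain k where k: "k \<in> B" "\<not> bounded (K k)"
    by blast
  have "interleaving_dist (interval_sum A J :: 'k pmodule) (interval_sum B K) < ereal r"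
    using assms by (simp add: class_dist_iso_class persistence_module_interval_sum)
  then obtain \<epsilon> where "0 \<le> \<epsilon>" "interleaved \<epsilon> (interval_sum A J :: 'k pmodule) (interval_sum B K)"
    by (auto simp: interleaving_dist_def Inf_less_iff)
  then show False
    using not_interleaved_unbounded[OF assms(1,2) k] by blast
qed


section \<open>The spaces of persistence modules\<close>

lemma ffid_within_subset_ffid: "ffid_within c d \<subseteq> (ffid :: 'k::field pclass set)"
  unfolding ffid_within_def ffid_def by blast

lemma ffid_subset_fid: "ffid \<subseteq> (fid :: 'k::field pclass set)"
  unfolding ffid_def fid_def by blast

lemma ffid_subset_cfid: "ffid \<subseteq> (cfid :: 'k::field pclass set)"
  unfolding ffid_def cfid_def by (rule Collect_mono) (metis countable_finite)

lemma cfid_subset_cid: "cfid \<subseteq> (cid :: 'k::field pclass set)"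
  unfolding cfid_def cid_def by blast

lemma fid_subset_cid: "fid \<subseteq> (cid :: 'k::field pclass set)"
  unfolding fid_def cid_def by (rule Collect_mono) (metis countable_finite)

lemma cid_subset_rid: "cid \<subseteq> (rid :: 'k::field pclass set)"
  unfolding cid_def rid_def by blast

lemma interval_sum_in_pfd:
  assumes "\<forall>i\<in>A. real_interval (J i)" "\<forall>a. finite {i\<in>A. a \<in> J i}"
  shows "iso_class (interval_sum A J) \<in> (pfd :: 'k::field pclass set)"
proof -
  have "\<exists>B. finite B \<and> fv.span B = pspace (interval_sum A J :: 'k pmodule) a" for a
    by (intro exI conjI, rule finite_imageI[OF assms(2)[rule_format]], rule span_indicators[OF assms(1)])
  moreover have "persistence_module (interval_sum A J :: 'k pmodule)"
    by (rule persistence_module_interval_sum[OF assms(1)])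
  ultimately show ?thesis
    unfolding pfd_def by blast
qed

lemma fid_subset_pfd: "fid \<subseteq> (pfd :: 'k::field pclass set)"
proof
  fix P :: "'k pclass"
  assume "P \<in> fid"
  then obtain A J where "P = iso_class (interval_sum A J)" "finite A" "\<forall>i\<in>A. real_interval (J i)"
    unfolding fid_def by blast
  then show "P \<in> pfd"
    using interval_sum_in_pfd[of A J] by simp
qed

lemma rid_subset_pers_classes: "rid \<subseteq> (pers_classes :: 'k::field pclass set)"
  unfolding rid_def using persistence_module_interval_sum by blast

lemma pfd_subset_pers_classes: "pfd \<subseteq> (pers_classes :: 'k::field pclass set)"
  unfolding pfd_def by blast

lemma zero_module_in_ffid_within:
  "iso_class zero_module \<in> (ffid_within c d :: 'k::field pclass set)"
  unfolding ffid_within_def by blast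

lemma infinite_copies_not_in_pfd:
  assumes "infinite A"
  shows "iso_class (interval_sum A (\<lambda>_. {0})) \<notin> (pfd :: 'k::field pclass set)"
proof
  let ?N = "interval_sum A (\<lambda>_. {0}) :: 'k pmodule"
  have N: "persistence_module ?N"
    by (intro persistence_module_interval_sum) (simp add: real_interval_singleton)
  assume "iso_class ?N \<in> (pfd :: 'k pclass set)"
  then obtain M :: "'k pmodule" where M: "iso_class ?N = iso_class M" "persistence_module M"
      "\<forall>a. \<exists>B. finite B \<and> fv.span B = pspace M a"
    unfolding pfd_def by (elim CollectE exE conjE) (rule that)
  obtain B where B: "finite B" "fv.span B = pspace M 0"
    using M(3) by blast
  obtain f where f: "fv.span (f ` B) = pspace ?N 0"
    by (rule spanning_set_iso[OF iso_class_eqD[OF M(1)[symmetric] M(2) N] B(2)])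
  have "finite (\<Union>g\<in>f ` B. {i. g i \<noteq> 0})"
    using B(1) finite_support_of_spanning_set[OF f] by blast
  then show False
    using spanning_set_covers_indices[OF f(1)] assms finite_subset by auto
qed

lemma uncountable_copies_not_in_cid:
  assumes "uncountable A"
  shows "iso_class (interval_sum A (\<lambda>_. {0})) \<notin> (cid :: 'k::field pclass set)"
proof
  let ?N = "interval_sum A (\<lambda>_. {0}) :: 'k pmodule"
  have N: "persistence_module ?N"
    by (intro persistence_module_interval_sum) (simp add: real_interval_singleton)
  assume "iso_class ?N \<in> (cid :: 'k pclass set)"
  then obtain B K where K: "iso_class ?N = iso_class (interval_sum B K :: 'k pmodule)" "countable B"
      "\<forall>i\<in>B. real_interval (K i)"
    unfolding cid_def by (elim CollectE exE conjE) (rule that)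
  have iso: "(interval_sum B K, ?N) \<in> iso_rel"
    by (rule iso_class_eqD[OF K(1)[symmetric] persistence_module_interval_sum[OF K(3)] N])
  define E :: "(real \<Rightarrow> 'k) set" where "E = (\<lambda>i. indicator {i}) ` {i\<in>B. 0 \<in> K i}"
  have "fv.span E = pspace (interval_sum B K) 0"
    unfolding E_def by (rule span_indicators[OF K(3)])
  then obtain f where f: "fv.span (f ` E) = pspace ?N 0"
    by (rule spanning_set_iso[OF iso])
  have "countable (f ` E)"
    unfolding E_def using K(2) by (intro countable_image countable_Collect)
  then have "countable (\<Union>g\<in>f ` E. {i. g i \<noteq> 0})"
    by (rule countable_UN) (rule countable_finite[OF finite_support_of_spanning_set[OF f]])
  then show False
    using spanning_set_covers_indices[OF f] assms countable_subset by auto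
qed

text \<open>
  In a sum isomorphic to this one, every \<open>n\<close> lies in some interval but no interval contains \<open>n\<close>
  and \<open>n + 1\<close>. An interval that contains \<open>n\<close> is then a different one for each \<open>n\<close>.
\<close>

lemma naturals_not_in_fid:
  "iso_class (interval_sum \<nat> (\<lambda>i. {i})) \<notin> (fid :: 'k::field pclass set)"
proof
  let ?N = "interval_sum \<nat> (\<lambda>i. {i}) :: 'k pmodule"
  have N: "persistence_module ?N"
    by (intro persistence_module_interval_sum) (simp add: real_interval_singleton)
  assume "iso_class ?N \<in> (fid :: 'k pclass set)"
  then obtain B K where K: "iso_class ?N = iso_class (interval_sum B K :: 'k pmodule)" "finite B"
      "\<forall>i\<in>B. real_interval (K i)"
    unfolding fid_def by (elim CollectE exE conjE) (rule that)
  have iso: "(?N, interval_sum B K) \<in> iso_rel"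
    by (rule iso_class_eqD[OF K(1) N persistence_module_interval_sum[OF K(3)]])
  then have iso': "(interval_sum B K, ?N) \<in> iso_rel"
    using equiv_iso_rel by (meson equivE symE)
  have "\<exists>i\<in>B. n \<in> K i" if "n \<in> \<nat>" for n
  proof -
    have "\<not> zero_map ?N n n"
      using that by (auto simp: zero_map_interval_sum_iff)
    then have "\<not> zero_map (interval_sum B K :: 'k pmodule) n n"
      using zero_map_iso[OF iso'] by blast
    then show ?thesis
      by (auto simp: zero_map_interval_sum_iff)
  qed
  then obtain h where h: "\<And>n. n \<in> \<nat> \<Longrightarrow> h n \<in> B \<and> n \<in> K (h n)"
    by metis
  have gap: "\<not> (n \<in> K i \<and> n + 1 \<in> K i)" if "i \<in> B" for i n
  proof -
    have "zero_map ?N n (n + 1)"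
      by (auto simp: zero_map_interval_sum_iff)
    then have "zero_map (interval_sum B K :: 'k pmodule) n (n + 1)"
      using zero_map_iso[OF iso] by simp
    then show ?thesis
      using that by (simp add: zero_map_interval_sum_iff)
  qed
  have "h n \<noteq> h m" if nm: "n \<in> \<nat>" "m \<in> \<nat>" "n < m" for n m
  proof
    assume eq: "h n = h m"
    have "n + 1 \<le> m"
      using nm by (auto simp: Nats_def)
    moreover have "n \<in> K (h n)" "m \<in> K (h n)" "h n \<in> B"
      using h nm eq by metis+
    ultimately have "n + 1 \<in> K (h n)"
      using K(3) unfolding real_interval_def is_interval_1
      by (metis less_add_one less_imp_le)
    then show False
      using gap \<open>n \<in> K (h n)\<close> \<open>h n \<in> B\<close> by blast
  qed
  then have "inj_on h \<nat>"
    by (intro linorder_inj_onI') auto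
  moreover have "h ` \<nat> \<subseteq> B"
    using h by auto
  ultimately show False
    using K(2) finite_subset inj_on_finite Nats_infinite by blast
qed

lemma point_not_in_ffid_within:
  assumes "p \<notin> {c..d}"
  shows "iso_class (interval_sum {0} (\<lambda>_. {p})) \<notin> (ffid_within c d :: 'k::field pclass set)"
proof
  let ?N = "interval_sum {0} (\<lambda>_. {p}) :: 'k pmodule"
  have N: "persistence_module ?N"
    by (intro persistence_module_interval_sum) (simp add: real_interval_singleton)
  assume "iso_class ?N \<in> (ffid_within c d :: 'k pclass set)"
  then obtain B K where K: "iso_class ?N = iso_class (interval_sum B K :: 'k pmodule)"
      "\<forall>i\<in>B. real_interval (K i) \<and> bounded (K i) \<and> K i \<subseteq> {c..d}"
    unfolding ffid_within_def by (elim CollectE exE conjE) (rule that)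
  have sum: "persistence_module (interval_sum B K :: 'k pmodule)"
    using K(2) by (intro persistence_module_interval_sum) simp
  have "\<forall>i\<in>B. p \<notin> K i"
    using K(2) assms by blast
  then have "zero_map (interval_sum B K :: 'k pmodule) p p"
    by (simp add: zero_map_interval_sum_iff)
  then have "zero_map ?N p p"
    using zero_map_iso[OF iso_class_eqD[OF K(1)[symmetric] sum N]] by simp
  then show False
    by (simp add: zero_map_interval_sum_iff)
qed

text \<open>Being bounded is preserved at every finite distance, so the radius \<open>1\<close> is arbitrary.\<close>

lemma openin_ffid_fid: "openin (dI_topology fid) (ffid :: 'k::field pclass set)"
proof (rule openin_dI_topologyI[OF ffid_subset_fid])
  show "fid \<subseteq> (pers_classes :: 'k pclass set)"
    using fid_subset_cid cid_subset_rid rid_subset_pers_classes by blast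
  fix P :: "'k pclass"
  assume "P \<in> ffid"
  then obtain A J where P: "P = iso_class (interval_sum A J)"
      "\<forall>i\<in>A. real_interval (J i) \<and> bounded (J i)"
    unfolding ffid_def by blast
  show "dI_ball fid P 1 \<subseteq> ffid"
  proof
    fix Q assume "Q \<in> dI_ball fid P 1"
    then obtain B K where Q: "Q = iso_class (interval_sum B K)" "finite B"
        "\<forall>i\<in>B. real_interval (K i)" and "class_dist P Q < ereal 1"
      unfolding dI_ball_def fid_def by blast
    then have "\<forall>i\<in>B. bounded (K i)"
      using bounded_if_class_dist_finite[OF P(2) Q(3)] P(1) by simp
    then show "Q \<in> ffid"
      unfolding ffid_def using Q by blast
  qed
qed

lemma openin_cfid_cid: "openin (dI_topology cid) (cfid :: 'k::field pclass set)"
proof (rule openin_dI_topologyI[OF cfid_subset_cid])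
  show "cid \<subseteq> (pers_classes :: 'k pclass set)"
    using cid_subset_rid rid_subset_pers_classes by blast
  fix P :: "'k pclass"
  assume "P \<in> cfid"
  then obtain A J where P: "P = iso_class (interval_sum A J)"
      "\<forall>i\<in>A. real_interval (J i) \<and> bounded (J i)"
    unfolding cfid_def by blast
  show "dI_ball cid P 1 \<subseteq> cfid"
  proof
    fix Q assume "Q \<in> dI_ball cid P 1"
    then obtain B K where Q: "Q = iso_class (interval_sum B K)" "countable B"
        "\<forall>i\<in>B. real_interval (K i)" and "class_dist P Q < ereal 1"
      unfolding dI_ball_def cid_def by blast
    then have "\<forall>i\<in>B. bounded (K i)"
      using bounded_if_class_dist_finite[OF P(2) Q(3)] P(1) by simp
    then show "Q \<in> cfid"
      unfolding cfid_def using Q by blast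
  qed
qed

theorem proposition4p1:
  fixes c d :: real
  assumes "c < d"
  shows
    "((ffid :: 'k::field pclass set) \<subseteq> fid
       \<and> openin (dI_topology fid) (ffid :: 'k pclass set))
   \<and> ((cfid :: 'k pclass set) \<subseteq> cid
       \<and> openin (dI_topology cid) (cfid :: 'k pclass set))
   \<and> ((ffid_within c d :: 'k pclass set) \<subseteq> ffid
       \<and> \<not> openin (dI_topology ffid) (ffid_within c d :: 'k pclass set))
   \<and> ((ffid :: 'k pclass set) \<subseteq> cfid
       \<and> \<not> openin (dI_topology cfid) (ffid :: 'k pclass set))
   \<and> ((fid :: 'k pclass set) \<subseteq> cid
       \<and> \<not> openin (dI_topology cid) (fid :: 'k pclass set))
   \<and> ((fid :: 'k pclass set) \<subseteq> pfd
       \<and> \<not> openin (dI_topology pfd) (fid :: 'k pclass set))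
   \<and> ((cid :: 'k pclass set) \<subseteq> rid
       \<and> \<not> openin (dI_topology rid) (cid :: 'k pclass set))
   \<and> (\<not> openin (dI_topology rid) (pfd :: 'k pclass set)
       \<and> \<not> openin (dI_topology rid) (pfd \<inter> rid :: 'k pclass set))"
proof -
  note subsets = ffid_within_subset_ffid[where 'k = 'k and c = c and d = d] ffid_subset_fid[where 'k = 'k]
    ffid_subset_cfid[where 'k = 'k] cfid_subset_cid[where 'k = 'k] fid_subset_cid[where 'k = 'k]
    cid_subset_rid[where 'k = 'k] fid_subset_pfd[where 'k = 'k]
    rid_subset_pers_classes[where 'k = 'k] pfd_subset_pers_classes[where 'k = 'k]
  have "ffid_within c d \<subseteq> (cid :: 'k pclass set)" "ffid_within c d \<subseteq> (rid :: 'k pclass set)"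
      "ffid_within c d \<subseteq> (pfd :: 'k pclass set)" "cfid \<subseteq> (rid :: 'k pclass set)"
    using subsets by blast+
  note subsets = subsets this
  have zero: "iso_class zero_module \<in> X" if "ffid_within c d \<subseteq> X" for X :: "'k pclass set"
    using zero_module_in_ffid_within that by blast
  have point: "real_interval {p}" "bounded {p}" for p :: real
    by (simp_all add: real_interval_singleton)
  have point_in: "iso_class (interval_sum {0} (\<lambda>_. {d + 1})) \<in> (ffid :: 'k pclass set)"
    unfolding ffid_def using point by blast
  have countable_in: "iso_class (interval_sum \<nat> (\<lambda>_. {0})) \<in> (cfid :: 'k pclass set)"
    unfolding cfid_def using point countable_image[of UNIV of_nat] by (auto simp: Nats_def)
  have uncountable_in: "iso_class (interval_sum UNIV (\<lambda>_. {0})) \<in> (rid :: 'k pclass set)"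
    unfolding rid_def using point by blast
  have naturals_in: "iso_class (interval_sum \<nat> (\<lambda>i. {i})) \<in> (pfd :: 'k pclass set)"
    using point by (intro interval_sum_in_pfd) auto
  note infinite = infinite_copies_not_in_pfd[OF Nats_infinite, where 'k = 'k]
  have "\<not> openin (dI_topology ffid) (ffid_within c d :: 'k pclass set)"
    using point_in point_not_in_ffid_within[of "d + 1" c d] subsets
    by (intro not_openin_dI_topology[where A = "{0}" and J = "\<lambda>_. {d + 1}"] zero) auto
  moreover have "\<not> openin (dI_topology cfid) (ffid :: 'k pclass set)"
    using countable_in infinite subsets
    by (intro not_openin_dI_topology[where A = "\<nat>" and J = "\<lambda>_. {0}"] zero) auto
  moreover have "\<not> openin (dI_topology cid) (fid :: 'k pclass set)"
    using countable_in infinite subsets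
    by (intro not_openin_dI_topology[where A = "\<nat>" and J = "\<lambda>_. {0}"] zero) auto
  moreover have "\<not> openin (dI_topology pfd) (fid :: 'k pclass set)"
    using naturals_in naturals_not_in_fid subsets
    by (intro not_openin_dI_topology[where A = "\<nat>" and J = "\<lambda>i. {i}"] zero) auto
  moreover have "\<not> openin (dI_topology rid) (cid :: 'k pclass set)"
    using uncountable_in uncountable_copies_not_in_cid[OF uncountable_UNIV_real] subsets
    by (intro not_openin_dI_topology[where A = UNIV and J = "\<lambda>_. {0}"] zero) auto
  moreover have "\<not> openin (dI_topology rid) (pfd :: 'k pclass set)"
    using countable_in infinite subsets
    by (intro not_openin_dI_topology[where A = "\<nat>" and J = "\<lambda>_. {0}"] zero) auto
  moreover have "\<not> openin (dI_topology rid) (pfd \<inter> rid :: 'k pclass set)"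
    using countable_in infinite subsets
    by (intro not_openin_dI_topology[where A = "\<nat>" and J = "\<lambda>_. {0}"] zero) auto
  ultimately show ?thesis
    using openin_ffid_fid openin_cfid_cid subsets by blast
qed

end
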